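(* The bilinear operation $(\Delta_1,\Delta_2)\mapsto \Delta_1\Delta_2$ defined in the context endows the vector space $A_\infty^{\circ}=\bigoplus_{n} A_n^{\circ}$ with the structure of a commutative associative algebra.
   Context: Vector spaces are over $\mathbb{C}$. For $n\ge 1$, $\mathcal{A}_n$ is the set of Young diagrams (partitions) of degree $|\Delta|=n$. The cyclic type of $g\in S_n$ is the Young diagram of degree $n$ whose row lengths are the lengths of all cycles of $g$ (fixed points included). $G_n(\Delta)\in\mathbb{C}[S_n]$ is the sum of all permutations of cyclic type $\Delta$. These sums form a basis of the center of $\mathbb{C}[S_n]$, and the structure constants $C_{\Delta_1,\Delta_2}^{\Delta}$ are defined by $G_n(\Delta_1)G_n(\Delta_2)=\sum_{\Delta\in\mathcal{A}_n}C_{\Delta_1,\Delta_2}^{\Delta}G_n(\Delta)$. $A_n^\circ$ is the vector space with basis $\mathcal{A}_n$ and multiplication $\Delta_1\circ\Delta_2=\sum_{\Delta\in\mathcal{A}_n}C_{\Delta_1,\Delta_2}^{\Delta}\Delta$ (so $A_n^\circ$ is isomorphic to the center of $\mathbb{C}[S_n]$). For $k\ge 0$, the linear map $\rho_k:A_n^\circ\to A_{n+k}^\circ$ is given on diagrams by $\rho_k(\Delta)=\frac{(r+k)!}{r!\,k!}\Delta^k$, where $\Delta^k$ is the diagram obtained from $\Delta$ by adding $k$ rows of length $1$, and $r$ is the number of rows of length $1$ in $\Delta$. For Young diagrams $\Delta_1,\Delta_2$ of arbitrary degrees, set $M=\max\{|\Delta_1|,|\Delta_2|\}$ and define elements $\{\Delta_1\Delta_2\}_n\in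 A_n^\circ$, $n\ge M$, recursively by $$\{\Delta_1\Delta_2\}_M=\rho_{M-|\Delta_1|}(\Delta_1)\circ\rho_{M-|\Delta_2|}(\Delta_2),$$ $$\{\Delta_1\Delta_2\}_n=\rho_{n-|\Delta_1|}(\Delta_1)\circ\rho_{n-|\Delta_2|}(\Delta_2)-\sum_{k=M}^{n-1}\rho_{n-k}(\{\Delta_1\Delta_2\}_k)\quad (n>M).$$ Then $\Delta_1\Delta_2:=\sum_{n=M}^{|\Delta_1|+|\Delta_2|}\{\Delta_1\Delta_2\}_n$, extended bilinearly to $A_\infty^\circ$. Algebras are not required to have a unit. *)

theory Defs
  imports Complex_Main "HOL-Library.Multiset" "HOL-Library.Poly_Mapping" "HOL-Combinatorics.Orbits"
begin

section \<open>Vector spaces with a given basis\<close>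

text \<open>
  The complex vector space with basis the elements of a type \<open>'a\<close> is the type
  \<open>'a \<Rightarrow>\<^sub>0 complex\<close> of finitely supported functions. The times operation that
  Poly_Mapping provides on this type for additive monoids \<open>'a\<close> is not used.
\<close>

definition cscale :: "complex \<Rightarrow> ('a \<Rightarrow>\<^sub>0 complex) \<Rightarrow> ('a \<Rightarrow>\<^sub>0 complex)" where
  "cscale c x = Poly_Mapping.map (\<lambda>a. c * a) x"

definition basis_vec :: "'a \<Rightarrow> ('a \<Rightarrow>\<^sub>0 complex)" where
  "basis_vec a = Poly_Mapping.single a 1"

definition linear_ext :: "('a \<Rightarrow> ('b \<Rightarrow>\<^sub>0 complex)) \<Rightarrow> ('a \<Rightarrow>\<^sub>0 complex) \<Rightarrow> ('b \<Rightarrow>\<^sub>0 complex)" where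
  "linear_ext f x = (\<Sum>a\<in>Poly_Mapping.keys x. cscale (Poly_Mapping.lookup x a) (f a))"

definition bilinear_ext ::
  "('a \<Rightarrow> 'b \<Rightarrow> ('c \<Rightarrow>\<^sub>0 complex)) \<Rightarrow> ('a \<Rightarrow>\<^sub>0 complex) \<Rightarrow> ('b \<Rightarrow>\<^sub>0 complex) \<Rightarrow> ('c \<Rightarrow>\<^sub>0 complex)" where
  "bilinear_ext f x y = linear_ext (\<lambda>a. linear_ext (\<lambda>b. f a b) y) x"

text \<open>Commutative associative algebras over a field, not required to have a unit.\<close>

locale comm_assoc_algebra = vector_space scale
  for scale :: "'k::field \<Rightarrow> 'v::ab_group_add \<Rightarrow> 'v" +
  fixes mult :: "'v \<Rightarrow> 'v \<Rightarrow> 'v"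
  assumes mult_add_left: "mult (x + y) z = mult x z + mult y z"
    and mult_add_right: "mult x (y + z) = mult x y + mult x z"
    and mult_scale_left: "mult (scale c x) y = scale c (mult x y)"
    and mult_scale_right: "mult x (scale c y) = scale c (mult x y)"
    and mult_assoc: "mult (mult x y) z = mult x (mult y z)"
    and mult_commute: "mult x y = mult y x"

section \<open>Young diagrams\<close>

text \<open>
  A Young diagram is the nonempty multiset of its (positive) row lengths; the empty
  diagram is excluded, as degrees are at least 1.
\<close>

typedef young = "{M :: nat multiset. M \<noteq> {#} \<and> 0 \<notin># M}"
  morphisms rows Abs_young
  by (rule exI[of _ "{#1#}"]) simp

setup_lifting type_definition_young

definition ydeg :: "young \<Rightarrow> nat" where
  "ydeg D = sum_mset (rows D)"

definition diagrams :: "nat \<Rightarrow> young set" where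
  "diagrams n = {D. ydeg D = n}"

lemma finite_diagrams: "finite (diagrams n)"
proof -
  have "rows ` diagrams n \<subseteq> mset ` {xs. set xs \<subseteq> {..n} \<and> length xs \<le> n}"
  proof
    fix M assume "M \<in> rows ` diagrams n"
    then have M: "sum_mset M = n" "0 \<notin># M"
      using rows by (auto simp: diagrams_def ydeg_def)
    obtain xs where xs: "mset xs = M" using ex_mset by blast
    have s: "sum_list xs = n" using M(1) xs by (metis sum_mset_sum_list)
    have z: "0 \<notin> set xs" using M(2) xs by auto
    have "length ys \<le> sum_list ys" if "0 \<notin> set ys" for ys :: "nat list"
      using that by (induction ys) auto
    moreover have "x \<le> n" if "x \<in> set xs" for x
      using member_le_sum_list[OF that] s by simp
    ultimately show "M \<in> mset ` {xs. set xs \<subseteq> {..n} \<and> length xs \<le> n}"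
      using xs s z by auto
  qed
  then have "finite (rows ` diagrams n)"
    using finite_lists_length_le[of "{..n}" n] finite_subset finite_imageI by blast
  then show ?thesis
    by (rule finite_imageD) (simp add: inj_on_def rows_inject)
qed

lift_definition add_unit_rows :: "nat \<Rightarrow> young \<Rightarrow> young" is
  "\<lambda>k M. M + replicate_mset k 1"
  by auto

section \<open>The center of the group algebra of the symmetric group\<close>

text \<open>
  The group algebra of \<open>S_n\<close>, with \<open>S_n\<close> the permutations of \<open>{1..n}\<close>, consists of the formal
  combinations supported on \<open>{g. g permutes {1..n}}\<close>; its product is the restriction of the
  following one.
\<close>

definition galg_mult :: "((nat \<Rightarrow> nat) \<Rightarrow>\<^sub>0 complex) \<Rightarrow> ((nat \<Rightarrow> nat) \<Rightarrow>\<^sub>0 complex) \<Rightarrow> ((nat \<Rightarrow> nat) \<Rightarrow>\<^sub>0 complex)" where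
  "galg_mult = bilinear_ext (\<lambda>g h. basis_vec (g \<circ> h))"

text \<open>The orbits form a set, so that every cycle, fixed points included, is counted once.\<close>

definition cycle_lengths :: "nat \<Rightarrow> (nat \<Rightarrow> nat) \<Rightarrow> nat multiset" where
  "cycle_lengths n g = image_mset card (mset_set (orbit g ` {1..n}))"

definition class_sum :: "nat \<Rightarrow> young \<Rightarrow> ((nat \<Rightarrow> nat) \<Rightarrow>\<^sub>0 complex)" where
  "class_sum n D = (\<Sum>g\<in>{g. g permutes {1..n} \<and> cycle_lengths n g = rows D}. basis_vec g)"

text \<open>
  For \<open>D1\<close>, \<open>D2\<close> of degree \<open>n\<close> the coefficients exist and are unique, because the class sums form a
  basis of the center of the group algebra. Requiring them to vanish outside \<open>diagrams n\<close> makes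
  the whole function \<open>C\<close> unique.
\<close>

definition structure_const :: "nat \<Rightarrow> young \<Rightarrow> young \<Rightarrow> young \<Rightarrow> complex" where
  "structure_const n D1 D2 =
    (THE C. (\<forall>D. D \<notin> diagrams n \<longrightarrow> C D = 0) \<and>
       galg_mult (class_sum n D1) (class_sum n D2) = (\<Sum>D\<in>diagrams n. cscale (C D) (class_sum n D)))"

section \<open>The product\<close>

text \<open>
  The direct sum over all \<open>n\<close> of the spaces with basis \<open>diagrams n\<close> is the space with basis
  all diagrams; the degree \<open>n\<close> summand consists of the elements supported on \<open>diagrams n\<close>.
\<close>

type_synonym A_inf = "young \<Rightarrow>\<^sub>0 complex"

text \<open>Used only on elements supported on \<open>diagrams n\<close>.\<close>

definition circ :: "nat \<Rightarrow> A_inf \<Rightarrow> A_inf \<Rightarrow> A_inf" where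
  "circ n = bilinear_ext
     (\<lambda>D1 D2. \<Sum>D\<in>diagrams n. cscale (structure_const n D1 D2 D) (basis_vec D))"

definition rho :: "nat \<Rightarrow> A_inf \<Rightarrow> A_inf" where
  "rho k = linear_ext
     (\<lambda>D. let r = count (rows D) 1
           in cscale (fact (r + k) / (fact r * fact k)) (basis_vec (add_unit_rows k D)))"

text \<open>
  Meaningful for \<open>n \<ge> max (ydeg D1) (ydeg D2)\<close>. For \<open>n\<close> equal to this maximum the sum
  over \<open>k\<close> is empty, which is the initial clause of the recursion.
\<close>

function brace :: "young \<Rightarrow> young \<Rightarrow> nat \<Rightarrow> A_inf" where
  "brace D1 D2 n =
     circ n (rho (n - ydeg D1) (basis_vec D1)) (rho (n - ydeg D2) (basis_vec D2))
     - (\<Sum>k\<in>{max (ydeg D1) (ydeg D2)..<n}. rho (n - k) (brace D1 D2 k))"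
  by pat_completeness auto
termination by (relation "measure (\<lambda>(D1, D2, n). n)") auto

declare brace.simps [simp del]

definition A_inf_mult :: "A_inf \<Rightarrow> A_inf \<Rightarrow> A_inf" where
  "A_inf_mult = bilinear_ext
     (\<lambda>D1 D2. \<Sum>n = max (ydeg D1) (ydeg D2)..ydeg D1 + ydeg D2. brace D1 D2 n)"

end

theory Submission
  imports Defs
begin

text \<open>
  Associativity is the point: the product on the direct sum is defined by a recursion with
  subtractions, which hides it. The proof identifies the product with a counting problem for partial
  permutations (in the manner of Ivanov and Kerov) and embeds the direct sum into the product of all
  the group algebras of \<open>S_n\<close>, where associativity is evident.

  A partial permutation is a pair of a finite set \<open>d\<close> and a permutation \<open>w\<close> of \<open>d\<close>; its diagram is
  the cycle type of \<open>w\<close> on \<open>d\<close>. Partial permutations multiply by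
  \<open>(d1, a) (d2, b) = (d1 \<union> d2, a \<circ> b)\<close>. Let \<open>\<psi>_n D\<close> be the sum, in the group algebra of \<open>S_n\<close>, of
  \<open>w\<close> over all \<open>(d, w)\<close> of diagram \<open>D\<close> with \<open>d \<subseteq> {1..n}\<close>; below it is \<open>partial_class_sum n D\<close>, and
  \<open>to_galg n\<close> is its linear extension. Three facts carry the proof.

  \<^item> The number of ways to write \<open>(d, g)\<close> as a product of partial permutations of diagrams \<open>D1\<close> and
  \<open>D2\<close> is invariant under relabelling of the points. As permutations of equal cycle type differ by
  a relabelling (\<open>conjugate_if_same_cycle_type\<close>), the number depends only on the diagram \<open>D\<close> of
  \<open>(d, g)\<close>; call it \<open>c D\<close>. Grouping the terms of \<open>\<psi>_n D1\<close> times \<open>\<psi>_n D2\<close> by the product of the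
  partial permutations gives, for every \<open>n\<close>, that this element equals the sum of \<open>c D\<close> times
  \<open>\<psi>_n D\<close> (\<open>galg_mult_partial_class_sum\<close>). Here \<open>c\<close> does not depend on \<open>n\<close>, and \<open>c D = 0\<close> unless the
  degree of \<open>D\<close> lies between \<open>max |D1| |D2|\<close> and \<open>|D1| + |D2|\<close>, because \<open>d\<close> is the union of the two
  domains.

  \<^item> A permutation of \<open>{1..n}\<close> can be restricted to an invariant set of diagram \<open>D\<close> by discarding
  fixed points, and the number of ways to do so is the binomial coefficient in the definition of
  \<open>\<rho>\<close>. Hence \<open>\<psi>_n D\<close> is the image of \<open>\<rho>_(n - |D|) D\<close> in the group algebra
  (\<open>to_galg_rho_basis_vec\<close>). So the previous identity is the recursion that defines the elements
  \<open>brace D1 D2 n\<close>, and \<open>brace D1 D2 n\<close> is the sum of \<open>c D\<close> times \<open>D\<close> over the diagrams of degree \<open>n\<close>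
  (\<open>brace_eq_product_part\<close>). In particular it vanishes for \<open>n > |D1| + |D2|\<close>: the truncated sum that
  defines the product loses nothing, and each \<open>to_galg n\<close> is multiplicative
  (\<open>to_galg_A_inf_mult\<close>).

  \<^item> The maps \<open>to_galg n\<close> are jointly injective: on an element with least degree \<open>n\<close>, the map
  \<open>to_galg n\<close> kills the terms of greater degree and sends the diagrams of degree \<open>n\<close> to disjoint
  conjugacy class sums (\<open>to_galg_jointly_injective\<close>).

  Associativity is thereby inherited from the group algebras. Commutativity is the symmetry of \<open>c\<close>,
  which comes from \<open>a \<circ> b = (a \<circ> b \<circ> a\<inverse>) \<circ> a\<close>.
\<close>

section \<open>Linear extension\<close>

lemma lookup_cscale [simp]:
  "Poly_Mapping.lookup (cscale c x) a = c * Poly_Mapping.lookup x a"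
  unfolding cscale_def by (simp add: Poly_Mapping.map.rep_eq when_def)

lemma lookup_basis_vec:
  "Poly_Mapping.lookup (basis_vec a) b = (if a = b then 1 else 0)"
  unfolding basis_vec_def by (simp add: lookup_single when_def)

lemma vector_space_cscale: "vector_space (cscale :: complex \<Rightarrow> ('a \<Rightarrow>\<^sub>0 complex) \<Rightarrow> _)"
  by unfold_locales (auto intro!: poly_mapping_eqI simp: lookup_add algebra_simps)

interpretation cvs: vector_space "cscale :: complex \<Rightarrow> ('a \<Rightarrow>\<^sub>0 complex) \<Rightarrow> _"
  by (rule vector_space_cscale)

lemma lookup_linear_ext:
  assumes "finite S" "Poly_Mapping.keys x \<subseteq> S"
  shows "Poly_Mapping.lookup (linear_ext f x) b =
    (\<Sum>a\<in>S. Poly_Mapping.lookup x a * Poly_Mapping.lookup (f a) b)"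
  unfolding linear_ext_def lookup_sum lookup_cscale
  by (rule sum.mono_neutral_left) (use assms in \<open>auto simp: in_keys_iff\<close>)

lemma linear_ext_add: "linear_ext f (x + y) = linear_ext f x + linear_ext f y"
proof (rule poly_mapping_eqI)
  fix b
  let ?S = "Poly_Mapping.keys x \<union> Poly_Mapping.keys y"
  have "Poly_Mapping.keys (x + y) \<subseteq> ?S" by (rule Poly_Mapping.keys_add)
  then show "Poly_Mapping.lookup (linear_ext f (x + y)) b
      = Poly_Mapping.lookup (linear_ext f x + linear_ext f y) b"
    by (simp add: lookup_linear_ext[of ?S] lookup_add sum.distrib algebra_simps)
qed

lemma linear_ext_cscale: "linear_ext f (cscale c x) = cscale c (linear_ext f x)"
proof (rule poly_mapping_eqI)
  fix b
  have "Poly_Mapping.keys (cscale c x) \<subseteq> Poly_Mapping.keys x"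
    by (auto simp: in_keys_iff)
  then show "Poly_Mapping.lookup (linear_ext f (cscale c x)) b
      = Poly_Mapping.lookup (cscale c (linear_ext f x)) b"
    by (simp add: lookup_linear_ext[of "Poly_Mapping.keys x"] sum_distrib_left mult.assoc)
qed

lemma linear_ext_0 [simp]: "linear_ext f 0 = 0"
  by (simp add: linear_ext_def)

lemma linear_ext_sum: "linear_ext f (\<Sum>i\<in>I. x i) = (\<Sum>i\<in>I. linear_ext f (x i))"
  by (induction I rule: infinite_finite_induct) (auto simp: linear_ext_add)

lemma linear_ext_diff: "linear_ext f (x - y) = linear_ext f x - linear_ext f y"
  using linear_ext_add[of f "x - y" y] by simp

lemma linear_ext_basis_vec [simp]: "linear_ext f (basis_vec a) = f a"
  by (rule poly_mapping_eqI) (simp add: lookup_linear_ext[of "{a}"] basis_vec_def)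

lemma linear_ext_fun_add: "linear_ext (\<lambda>a. f a + g a) x = linear_ext f x + linear_ext g x"
  by (simp add: linear_ext_def cvs.scale_right_distrib sum.distrib)

lemma linear_ext_fun_cscale: "linear_ext (\<lambda>a. cscale c (f a)) x = cscale c (linear_ext f x)"
  by (simp add: linear_ext_def cvs.scale_sum_right mult.commute)

text \<open>A linear map is determined by its values on basis vectors. In this form the fact serves to move
  a linear map inside a linear extension, so that identities between multilinear expressions reduce
  to identities between basis vectors.\<close>

lemma linear_map_linear_ext:
  fixes L :: "('b \<Rightarrow>\<^sub>0 complex) \<Rightarrow> ('c \<Rightarrow>\<^sub>0 complex)" and f :: "'a \<Rightarrow> ('b \<Rightarrow>\<^sub>0 complex)"
  assumes add: "\<And>x y. L (x + y) = L x + L y"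
    and scale: "\<And>c x. L (cscale c x) = cscale c (L x)"
  shows "L (linear_ext f x) = linear_ext (\<lambda>a. L (f a)) x"
proof -
  have 0: "L 0 = 0" using add[of 0 0] by simp
  have "L (\<Sum>i\<in>I. g i) = (\<Sum>i\<in>I. L (g i))" for I :: "'a set" and g
    by (induction I rule: infinite_finite_induct) (auto simp: add 0)
  then show ?thesis by (simp add: linear_ext_def scale)
qed

lemma bilinear_ext_basis_vec [simp]: "bilinear_ext f (basis_vec a) (basis_vec b) = f a b"
  by (simp add: bilinear_ext_def)

lemma bilinear_ext_add_left: "bilinear_ext f (x + x') y = bilinear_ext f x y + bilinear_ext f x' y"
  and bilinear_ext_add_right: "bilinear_ext f x (y + y') = bilinear_ext f x y + bilinear_ext f x y'"
  and bilinear_ext_cscale_left: "bilinear_ext f (cscale c x) y = cscale c (bilinear_ext f x y)"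
  and bilinear_ext_cscale_right: "bilinear_ext f x (cscale c y) = cscale c (bilinear_ext f x y)"
  by (simp_all add: bilinear_ext_def linear_ext_add linear_ext_cscale linear_ext_fun_add
      linear_ext_fun_cscale)

lemmas bilinear_ext_linear = bilinear_ext_add_left bilinear_ext_add_right
  bilinear_ext_cscale_left bilinear_ext_cscale_right

lemma bilinear_ext_linear_ext_left:
  "bilinear_ext f (linear_ext g x) z = linear_ext (\<lambda>a. bilinear_ext f (g a) z) x"
  by (rule linear_map_linear_ext) (simp_all add: bilinear_ext_linear)

lemma bilinear_ext_linear_ext_right:
  "bilinear_ext f z (linear_ext g x) = linear_ext (\<lambda>a. bilinear_ext f z (g a)) x"
  by (rule linear_map_linear_ext) (simp_all add: bilinear_ext_linear)

lemma linear_ext_linear_ext: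
  "linear_ext f (linear_ext g x) = linear_ext (\<lambda>a. linear_ext f (g a)) x"
  by (rule linear_map_linear_ext) (simp_all add: linear_ext_add linear_ext_cscale)

lemma linear_ext_bilinear_ext:
  "linear_ext g (bilinear_ext f x y) = bilinear_ext (\<lambda>a b. linear_ext g (f a b)) x y"
  by (simp add: bilinear_ext_def linear_ext_linear_ext)

lemma bilinear_ext_linear_exts:
  "bilinear_ext f (linear_ext g x) (linear_ext h y) =
    bilinear_ext (\<lambda>a b. bilinear_ext f (g a) (h b)) x y"
  unfolding bilinear_ext_linear_ext_left
  by (simp only: bilinear_ext_linear_ext_right
      bilinear_ext_def[of "\<lambda>a b. bilinear_ext f (g a) (h b)"])

lemma bilinear_ext_sum_left:
  "bilinear_ext f (\<Sum>i\<in>I. x i) z = (\<Sum>i\<in>I. bilinear_ext f (x i) z)"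
  by (simp add: bilinear_ext_def linear_ext_sum)

lemma bilinear_ext_0_right: "bilinear_ext f x 0 = 0"
  using bilinear_ext_add_right[of f x 0 0] by simp

lemma bilinear_ext_sum_right:
  "bilinear_ext f z (\<Sum>i\<in>I. x i) = (\<Sum>i\<in>I. bilinear_ext f z (x i))"
  by (induction I rule: infinite_finite_induct)
    (simp_all add: bilinear_ext_add_right bilinear_ext_0_right)

text \<open>Both sides expand trilinearly, and composition of permutations is associative.\<close>

lemma galg_mult_assoc: "galg_mult (galg_mult x y) z = galg_mult x (galg_mult y z)"
proof -
  have "galg_mult (galg_mult x y) z =
      linear_ext (\<lambda>a. linear_ext (\<lambda>b. linear_ext (\<lambda>c. basis_vec (a \<circ> b \<circ> c)) z) y) x"
    unfolding galg_mult_def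
    by (simp add: bilinear_ext_def linear_ext_linear_ext)
  moreover have "galg_mult x (galg_mult y z) =
      linear_ext (\<lambda>a. linear_ext (\<lambda>b. linear_ext (\<lambda>c. basis_vec (a \<circ> (b \<circ> c))) z) y) x"
    unfolding galg_mult_def
    by (simp add: bilinear_ext_def linear_ext_linear_ext)
  ultimately show ?thesis by (simp add: comp_assoc)
qed

lemma bilinear_ext_commute:
  fixes f :: "'a \<Rightarrow> 'a \<Rightarrow> ('b \<Rightarrow>\<^sub>0 complex)"
  assumes "\<And>a b. f a b = f b a"
  shows "bilinear_ext f x y = bilinear_ext f y x"
proof -
  have *: "bilinear_ext f x y =
      (\<Sum>a\<in>Poly_Mapping.keys x. \<Sum>b\<in>Poly_Mapping.keys y.
        cscale (Poly_Mapping.lookup x a * Poly_Mapping.lookup y b) (f a b))" for x y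
    by (simp add: bilinear_ext_def linear_ext_def cvs.scale_sum_right)
  show ?thesis
    unfolding *[of x y] *[of y x] by (subst sum.swap) (simp add: assms mult.commute)
qed

section \<open>Cycle types\<close>

text \<open>The cycle type relative to an arbitrary carrier \<open>d\<close>; for \<open>d = {1..n}\<close> it is \<open>cycle_lengths n\<close>.\<close>

definition cycle_type :: "'a set \<Rightarrow> ('a \<Rightarrow> 'a) \<Rightarrow> nat multiset" where
  "cycle_type d w = image_mset card (mset_set (orbit w ` d))"

lemma self_in_orbit: "w permutes d \<Longrightarrow> finite d \<Longrightarrow> x \<in> orbit w x"
  by (rule permutation_self_in_orbit) (rule permutes_imp_permutation)

lemma orbit_eq_of_mem: "w permutes d \<Longrightarrow> finite d \<Longrightarrow> y \<in> orbit w x \<Longrightarrow> orbit w y = orbit w x"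
  by (rule orbit_cyclic_eq3[OF cyclic_on_orbit])

lemma cycle_type_cong:
  "(\<And>x. x \<in> d \<Longrightarrow> orbit w x = orbit w' x) \<Longrightarrow> cycle_type d w = cycle_type d w'"
  by (simp add: cycle_type_def cong: image_cong)

lemma cycle_type_Un:
  assumes "finite d" "finite e" "d \<inter> e = {}"
    and "\<And>x. x \<in> d \<Longrightarrow> orbit w x \<subseteq> d" "\<And>x. x \<in> e \<Longrightarrow> orbit w x \<subseteq> e"
  shows "cycle_type (d \<union> e) w = cycle_type d w + cycle_type e w"
proof -
  have "orbit w ` d \<inter> orbit w ` e = {}"
  proof (rule ccontr)
    assume "orbit w ` d \<inter> orbit w ` e \<noteq> {}"
    then obtain x y where "x \<in> d" "y \<in> e" "orbit w x = orbit w y" by auto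
    then have "w x \<in> d" "w x \<in> e" using assms(4)[of x] assms(5)[of y] orbit.base[of w x] by auto
    with assms(3) show False by blast
  qed
  then show ?thesis
    using assms(1,2) by (simp add: cycle_type_def image_Un mset_set_Union)
qed

lemma orbit_fixed: "w x = x \<Longrightarrow> orbit w x = {x}"
  by (simp add: orbit_eq_singleton_iff)

lemma cycle_type_fixed:
  assumes "\<And>x. x \<in> d \<Longrightarrow> w x = x"
  shows "cycle_type d w = replicate_mset (card d) 1"
proof -
  have "cycle_type d w = image_mset card (mset_set ((\<lambda>x. {x}) ` d))"
    unfolding cycle_type_def using assms by (simp add: orbit_fixed cong: image_cong)
  also have "\<dots> = image_mset card (image_mset (\<lambda>x. {x}) (mset_set d))"
    by (subst image_mset_mset_set) auto
  finally show ?thesis by (simp add: multiset.map_comp comp_def image_mset_const_eq)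
qed

text \<open>Enlarging the domain of a partial permutation only adds fixed points. This is the combinatorial
  meaning of adding rows of length 1 to a diagram.\<close>

lemma cycle_type_mono:
  assumes "w permutes d" "d \<subseteq> e" "finite e"
  shows "cycle_type e w = cycle_type d w + replicate_mset (card e - card d) 1"
proof -
  have outside: "x \<notin> d \<Longrightarrow> w x = x" for x
    using assms(1) by (rule permutes_not_in)
  have "cycle_type (d \<union> (e - d)) w = cycle_type d w + cycle_type (e - d) w"
  proof (rule cycle_type_Un)
    show "finite d" by (rule finite_subset[OF assms(2,3)])
    show "orbit w x \<subseteq> d" if "x \<in> d" for x by (rule permutes_orbit_subset[OF assms(1) that])
    show "orbit w x \<subseteq> e - d" if "x \<in> e - d" for x
      using that orbit_fixed[of w x] outside[of x] by simp
  qed (use assms(3) in auto)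
  moreover have "cycle_type (e - d) w = replicate_mset (card (e - d)) 1"
    by (rule cycle_type_fixed) (simp add: outside)
  moreover have "d \<union> (e - d) = e" using assms(2) by blast
  ultimately show ?thesis
    using card_Diff_subset[OF finite_subset[OF assms(2,3)] assms(2)] by simp
qed

text \<open>The orbits partition the domain.\<close>

lemma sum_mset_cycle_type:
  assumes "w permutes d" "finite d"
  shows "sum_mset (cycle_type d w) = card d"
proof -
  have "sum_mset (cycle_type d w) = (\<Sum>B\<in>orbit w ` d. card B)"
    by (simp add: cycle_type_def sum_unfold_sum_mset)
  also have "\<dots> = card (\<Union>(orbit w ` d))"
  proof (rule card_Union_disjoint[symmetric])
    show "pairwise disjnt (orbit w ` d)"
    proof (rule pairwiseI)
      fix A B assume AB: "A \<in> orbit w ` d" "B \<in> orbit w ` d" "A \<noteq> B"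
      then obtain x y where xy: "A = orbit w x" "B = orbit w y" by blast
      have "A = B" if "z \<in> A" "z \<in> B" for z
        using orbit_eq_of_mem[OF assms, of z] that unfolding xy by metis
      with AB(3) show "disjnt A B" by (auto simp: disjnt_iff)
    qed
  qed (use finite_orbit[OF self_in_orbit[OF assms]] in blast)
  also have "\<Union>(orbit w ` d) = d"
    using permutes_orbit_subset[OF assms(1)] self_in_orbit[OF assms] by blast
  finally show ?thesis .
qed

lemma zero_notin_cycle_type:
  assumes "w permutes d" "finite d"
  shows "0 \<notin># cycle_type d w"
proof
  assume "0 \<in># cycle_type d w"
  then obtain x where "x \<in> d" "card (orbit w x) = 0"
    using assms by (auto simp: cycle_type_def)
  moreover have "finite (orbit w x)" by (rule finite_orbit[OF self_in_orbit[OF assms]])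
  ultimately show False using orbit_nonempty[of w x] by auto
qed

lemma cycle_type_empty [simp]: "cycle_type {} w = {#}"
  by (simp add: cycle_type_def)

lemma cycle_type_eq_empty_iff: "finite d \<Longrightarrow> cycle_type d w = {#} \<longleftrightarrow> d = {}"
  by (auto simp: cycle_type_def mset_set_empty_iff)

lemma count_1_cycle_type:
  assumes "w permutes d" "finite d"
  shows "count (cycle_type d w) 1 = card {x \<in> d. w x = x}"
proof -
  let ?e = "{x \<in> d. w x \<noteq> x}"
  have e: "w permutes ?e" by (rule permutes_superset[OF assms(1)]) auto
  have "1 \<notin># cycle_type ?e w"
  proof
    assume "1 \<in># cycle_type ?e w"
    then obtain x where x: "x \<in> d" "w x \<noteq> x" "card (orbit w x) = 1"
      using assms by (auto simp: cycle_type_def)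
    then obtain z where "orbit w x = {z}" by (auto simp: card_1_singleton_iff)
    then have "orbit w x = {x}" using self_in_orbit[OF assms, of x] by auto
    with x(2) show False by (simp add: orbit_eq_singleton_iff)
  qed
  then have "count (cycle_type ?e w) 1 = 0" by (simp add: not_in_iff)
  moreover have "cycle_type d w = cycle_type ?e w + replicate_mset (card d - card ?e) 1"
    using e assms(2) by (intro cycle_type_mono) auto
  ultimately have "count (cycle_type d w) 1 = card d - card ?e" by simp
  also have "\<dots> = card (d - ?e)" using assms(2) by (simp add: card_Diff_subset)
  also have "d - ?e = {x \<in> d. w x = x}" by auto
  finally show ?thesis .
qed

text \<open>A domain of \<open>w\<close> with type \<open>R\<close> arises from \<open>e\<close> by discarding \<open>k\<close> of the fixed points of \<open>w\<close>, of
  which there are \<open>count R 1 + k\<close>. This is where the factor in the definition of \<open>rho\<close> comes from.\<close>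

lemma card_invariant_subsets_of_cycle_type:
  assumes w: "w permutes e" and e: "finite e"
    and type: "cycle_type e w = R + replicate_mset k 1"
  shows "card {d. d \<subseteq> e \<and> w permutes d \<and> cycle_type d w = R} = (count R 1 + k) choose k"
proof -
  let ?Fix = "{x \<in> e. w x = x}"
  have size: "card e = sum_mset R + k"
    using sum_mset_cycle_type[OF w e] type by simp
  have "bij_betw (\<lambda>F. e - F) {F. F \<subseteq> ?Fix \<and> card F = k}
      {d. d \<subseteq> e \<and> w permutes d \<and> cycle_type d w = R}"
  proof (rule bij_betwI)
    show "(\<lambda>F. e - F) \<in> {F. F \<subseteq> ?Fix \<and> card F = k} \<rightarrow>
        {d. d \<subseteq> e \<and> w permutes d \<and> cycle_type d w = R}"
    proof safe
      fix F assume F: "F \<subseteq> ?Fix" "k = card F"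
      show p: "w permutes (e - F)" by (rule permutes_superset[OF w]) (use F in auto)
      have fin: "finite F" "F \<subseteq> e" using F(1) e by (auto intro: finite_subset)
      then have "card e - card (e - F) = k"
        using F(2) card_mono[OF e fin(2)] by (simp add: card_Diff_subset)
      then show "cycle_type (e - F) w = R"
        using cycle_type_mono[OF p _ e] type by simp
    qed
    show "(\<lambda>d. e - d) \<in> {d. d \<subseteq> e \<and> w permutes d \<and> cycle_type d w = R} \<rightarrow>
        {F. F \<subseteq> ?Fix \<and> card F = k}"
    proof safe
      fix d assume d: "d \<subseteq> e" "w permutes d" "R = cycle_type d w"
      then have "card d = sum_mset R" using sum_mset_cycle_type e finite_subset by metis
      then show "card (e - d) = k"
        using size card_Diff_subset[OF finite_subset[OF d(1) e] d(1)] by simp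
    qed (auto simp: permutes_not_in)
  qed auto
  then have "card {d. d \<subseteq> e \<and> w permutes d \<and> cycle_type d w = R} =
      card {F. F \<subseteq> ?Fix \<and> card F = k}"
    by (simp add: bij_betw_same_card)
  also have "\<dots> = card ?Fix choose k" using e by (intro n_subsets) auto
  also have "card ?Fix = count R 1 + k"
    using count_1_cycle_type[OF w e] type by simp
  finally show ?thesis .
qed

section \<open>Conjugation and cycle types\<close>

lemma permutes_conjugate:
  assumes "bij F" "w permutes d"
  shows "F \<circ> w \<circ> inv F permutes F ` d"
proof (rule bij_imp_permutes)
  have "bij_betw (inv F) (F ` d) d"
    using assms(1) by (metis bij_betw_inv_into bij_betw_subset bij_betw_def subset_UNIV
        image_inv_f_f)
  moreover have "bij_betw F d (F ` d)"
    using assms(1) by (meson bij_betw_subset subset_UNIV)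
  ultimately show "bij_betw (F \<circ> w \<circ> inv F) (F ` d) (F ` d)"
    using permutes_imp_bij[OF assms(2)]
    by (metis bij_betw_trans comp_assoc)
next
  fix x assume "x \<notin> F ` d"
  then have "inv F x \<notin> d" using assms(1) by (metis bij_inv_eq_iff image_eqI)
  then show "(F \<circ> w \<circ> inv F) x = x"
    using assms by (simp add: permutes_not_in bij_is_surj surj_f_inv_f)
qed

lemma cycle_type_conjugate:
  assumes "bij F" "w permutes d" "finite d"
  shows "cycle_type (F ` d) (F \<circ> w \<circ> inv F) = cycle_type d w"
proof -
  have inj: "inj F" by (rule bij_is_inj[OF assms(1)])
  have "F ` orbit w x = orbit (F \<circ> w \<circ> inv F) (F x)" for x
    by (rule orbit_inverse[OF self_in_orbit[OF assms(2,3)]]) (simp add: inv_f_f[OF inj])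
  then have "orbit (F \<circ> w \<circ> inv F) ` F ` d = image F ` orbit w ` d"
    by (simp add: image_image)
  moreover have "inj_on (image F) (orbit w ` d)"
    using inj by (meson inj_on_def inj_image_eq_iff)
  ultimately show ?thesis
    by (simp add: cycle_type_def image_mset_mset_set[symmetric] multiset.map_comp comp_def
        card_image[OF inj_on_subset[OF inj]])
qed

lemma orbit_as_funpow:
  assumes "x \<in> orbit w x"
  shows "bij_betw (\<lambda>i. (w ^^ i) x) {..<card (orbit w x)} (orbit w x)"
    and "(w ^^ card (orbit w x)) x = x"
proof -
  let ?p = "funpow_dist1 w x x"
  have bij: "bij_betw (\<lambda>i. (w ^^ i) x) {0..<?p} (orbit w x)"
    using inj_on_funpow_dist1[OF assms] orbit_conv_funpow_dist1[OF assms]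
    by (simp add: bij_betw_def)
  then have p: "card (orbit w x) = ?p" using bij_betw_same_card by fastforce
  show "bij_betw (\<lambda>i. (w ^^ i) x) {..<card (orbit w x)} (orbit w x)"
    using bij p by (simp add: lessThan_atLeast0)
  show "(w ^^ card (orbit w x)) x = x" unfolding p by (rule funpow_dist1_prop[OF assms])
qed

text \<open>Send the \<open>i\<close>-th iterate of \<open>x\<close> to the \<open>i\<close>-th iterate of \<open>y\<close>; since the orbits have the same
  length, both enumerations close up at the same index.\<close>

lemma equivariant_bij_orbits:
  assumes x: "x \<in> orbit w x" and y: "y \<in> orbit v y"
    and card: "card (orbit w x) = card (orbit v y)"
  shows "\<exists>f. bij_betw f (orbit w x) (orbit v y) \<and> (\<forall>z\<in>orbit w x. f (w z) = v (f z))"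
proof -
  let ?m = "card (orbit w x)"
  let ?a = "\<lambda>i. (w ^^ i) x" and ?b = "\<lambda>i. (v ^^ i) y"
  have a: "bij_betw ?a {..<?m} (orbit w x)" and a0: "?a ?m = x"
    using orbit_as_funpow[OF x] by auto
  have b: "bij_betw ?b {..<?m} (orbit v y)" and b0: "?b ?m = y"
    using orbit_as_funpow[OF y] card by auto
  define f where "f = ?b \<circ> inv_into {..<?m} ?a"
  have f: "f (?a i) = ?b i" if "i < ?m" for i
    using bij_betw_inv_into_left[OF a, of i] that by (simp add: f_def)
  have "bij_betw f (orbit w x) (orbit v y)"
    unfolding f_def by (rule bij_betw_trans[OF bij_betw_inv_into[OF a] b])
  moreover have "f (w z) = v (f z)" if "z \<in> orbit w x" for z
  proof -
    have "z \<in> ?a ` {..<?m}" using that unfolding bij_betw_imp_surj_on[OF a] .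
    then obtain i where i: "i < ?m" "z = ?a i" by blast
    have wz: "w z = ?a (Suc i)" using i by simp
    show ?thesis
    proof (cases "Suc i < ?m")
      case True
      then show ?thesis using f[OF True] f[OF i(1)] i(2) wz by simp
    next
      case False
      \<comment> \<open>the step at which both orbits return to their starting points\<close>
      then have eq: "Suc i = ?m" using i by simp
      then have "w z = ?a 0" using wz a0 by simp
      then have "f (w z) = ?b 0" using f[of 0] i(1) by simp
      also have "\<dots> = ?b (Suc i)" using eq b0 by simp
      finally show ?thesis using f[OF i(1)] i(2) by simp
    qed
  qed
  ultimately show ?thesis by blast
qed

lemma cycle_type_remove_orbit:
  assumes w: "w permutes d" and d: "finite d" and x: "x \<in> d"
  defines "e \<equiv> d - orbit w x"
  shows "perm_restrict w e permutes e"
    and "cycle_type d w = add_mset (card (orbit w x)) (cycle_type e (perm_restrict w e))"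
proof -
  let ?O = "orbit w x"
  show e: "perm_restrict w e permutes e"
    unfolding e_def by (rule perm_restrict_diff_cyclic[OF w cyclic_on_orbit[OF w d]])
  have sub: "?O \<subseteq> d" by (rule permutes_orbit_subset[OF w x])
  have orb: "orbit w z = orbit (perm_restrict w e) z" if "z \<in> e" for z
  proof (rule orbit_cong0[OF that, symmetric])
    show "perm_restrict w e \<in> e \<rightarrow> e" using permutes_in_image[OF e] by blast
  qed (simp add: perm_restrict_simps)
  have "cycle_type (?O \<union> e) w = cycle_type ?O w + cycle_type e w"
  proof (rule cycle_type_Un)
    show "orbit w z \<subseteq> e" if "z \<in> e" for z
      using permutes_orbit_subset[OF e that] orb[OF that] by simp
    show "finite ?O" by (rule finite_subset[OF sub d])
    show "orbit w z \<subseteq> ?O" if "z \<in> ?O" for z using orbit_eq_of_mem[OF w d that] by simp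
  qed (use d in \<open>auto simp: e_def\<close>)
  moreover have "?O \<union> e = d" using sub by (auto simp: e_def)
  moreover have "orbit w ` ?O = {?O}"
    using orbit_eq_of_mem[OF w d] self_in_orbit[OF w d, of x] by blast
  then have "cycle_type ?O w = {#card ?O#}" by (simp add: cycle_type_def)
  moreover have "cycle_type e w = cycle_type e (perm_restrict w e)"
    by (rule cycle_type_cong) (rule orb)
  ultimately show "cycle_type d w = add_mset (card ?O) (cycle_type e (perm_restrict w e))"
    by simp
qed

text \<open>Match one orbit of \<open>w\<close> with an orbit of \<open>v\<close> of the same size, remove both, and use induction on
  the remaining sets.\<close>

lemma equivariant_bij_of_cycle_type:
  assumes "finite d" "w permutes d" "finite d'" "v permutes d'"
    and "cycle_type d w = cycle_type d' v"
  shows "\<exists>f. bij_betw f d d' \<and> (\<forall>x\<in>d. f (w x) = v (f x))"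
  using assms
proof (induction d arbitrary: w d' v rule: finite_psubset_induct)
  case (psubset d)
  show ?case
  proof (cases "d = {}")
    case True
    then have "d' = {}" using psubset.prems cycle_type_eq_empty_iff[of d' v] by simp
    then show ?thesis using True by (simp add: bij_betw_def)
  next
    case False
    then obtain x where x: "x \<in> d" by blast
    note w = psubset.prems(1) and d' = psubset.prems(2) and v = psubset.prems(3)
    let ?O = "orbit w x"
    have "card ?O \<in># cycle_type d w"
      using x psubset.hyps by (simp add: cycle_type_def)
    then obtain y where y: "y \<in> d'" "card ?O = card (orbit v y)"
      using d' unfolding psubset.prems(4) by (auto simp: cycle_type_def)
    let ?P = "orbit v y"
    let ?e = "d - ?O" and ?e' = "d' - ?P"
    note rw = cycle_type_remove_orbit[OF w psubset.hyps x]
    note rv = cycle_type_remove_orbit[OF v d' y(1)]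
    have selfx: "x \<in> ?O" and selfy: "y \<in> ?P"
      using self_in_orbit[OF w psubset.hyps] self_in_orbit[OF v d'] by auto
    have "?e \<subset> d" using x selfx by blast
    moreover have "cycle_type ?e (perm_restrict w ?e) = cycle_type ?e' (perm_restrict v ?e')"
      using psubset.prems(4) rw(2) rv(2) y(2) by simp
    ultimately obtain f where f: "bij_betw f ?e ?e'"
      "\<And>z. z \<in> ?e \<Longrightarrow> f (perm_restrict w ?e z) = perm_restrict v ?e' (f z)"
      using psubset.IH[OF _ rw(1) _ rv(1)] d' by blast
    obtain h where h: "bij_betw h ?O ?P" "\<And>z. z \<in> ?O \<Longrightarrow> h (w z) = v (h z)"
      using equivariant_bij_orbits[OF selfx selfy y(2)] by blast
    let ?k = "\<lambda>z. if z \<in> ?O then h z else f z"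
    have "bij_betw ?k (?O \<union> ?e) (?P \<union> ?e')"
    proof (rule bij_betw_combine)
      show "bij_betw ?k ?O ?P" using h(1) by (simp cong: bij_betw_cong)
      show "bij_betw ?k ?e ?e'" using f(1) by (subst bij_betw_cong[of _ _ f]) auto
    qed auto
    moreover have "?O \<union> ?e = d" "?P \<union> ?e' = d'"
      using permutes_orbit_subset[OF w x] permutes_orbit_subset[OF v y(1)] by auto
    ultimately have "bij_betw ?k d d'" by simp
    moreover have "?k (w z) = v (?k z)" if "z \<in> d" for z
    proof (cases "z \<in> ?O")
      case True
      then show ?thesis using h(2)[OF True] orbit.step[OF True] by simp
    next
      case False
      then have z: "z \<in> ?e" using that by blast
      then have "w z \<in> ?e"
        using permutes_in_image[OF rw(1), of z] by (simp add: perm_restrict_simps)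
      moreover have "f z \<in> ?e'" using f(1) z by (auto simp: bij_betw_def)
      ultimately show ?thesis
        using f(2)[OF z] False z by (simp add: perm_restrict_simps)
    qed
    ultimately show ?thesis by blast
  qed
qed

text \<open>Since \<open>A\<close> and \<open>B\<close> have the same number of elements, so do \<open>B - A\<close> and \<open>A - B\<close>; a bijection between
  the latter completes the given one to a permutation of \<open>A \<union> B\<close>. A relabelling that is defined
  everywhere lets conjugation act on all partial permutations at once.\<close>

lemma extend_bij_betw_finite:
  fixes A B :: "'a set"
  assumes f: "bij_betw f A B" and A: "finite A"
  shows "\<exists>F. bij F \<and> (\<forall>x\<in>A. F x = f x)"
proof -
  have B: "finite B" and card: "card A = card B"
    using bij_betw_finite[OF f] A bij_betw_same_card[OF f] by auto
  have "card (B - A) = card (A - B)"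
    using A B card by (metis card_le_sym_Diff card_Diff_subset_Int finite_Int inf_commute)
  then obtain h where h: "bij_betw h (B - A) (A - B)"
    using A B by (meson finite_Diff finite_same_card_bij)
  let ?F = "\<lambda>x. if x \<in> A then f x else if x \<in> B then h x else x"
  have "bij_betw ?F (A \<union> (B - A)) (B \<union> (A - B))"
  proof (rule bij_betw_combine)
    show "bij_betw ?F A B" using f by (simp cong: bij_betw_cong)
    show "bij_betw ?F (B - A) (A - B)" using h by (subst bij_betw_cong[of _ _ h]) auto
  qed auto
  moreover have "A \<union> (B - A) = A \<union> B" "B \<union> (A - B) = A \<union> B" by auto
  ultimately have "?F permutes (A \<union> B)" by (intro bij_imp_permutes) auto
  then have "bij ?F" by (rule permutes_bij)
  then show ?thesis by (intro exI[of _ ?F]) auto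
qed

lemma conjugate_if_same_cycle_type:
  fixes d d' :: "'a set"
  assumes "finite d" "w permutes d" "finite d'" "v permutes d'"
    and "cycle_type d w = cycle_type d' v"
  shows "\<exists>F. bij F \<and> F ` d = d' \<and> v = F \<circ> w \<circ> inv F"
proof -
  obtain f where f: "bij_betw f d d'" "\<And>x. x \<in> d \<Longrightarrow> f (w x) = v (f x)"
    using equivariant_bij_of_cycle_type[OF assms] by blast
  obtain F where F: "bij F" "\<And>x. x \<in> d \<Longrightarrow> F x = f x"
    using extend_bij_betw_finite[OF f(1) assms(1)] by blast
  have im: "F ` d = d'" using f(1) F(2) by (simp add: bij_betw_def cong: image_cong)
  have comm: "v (F x) = F (w x)" for x
  proof (cases "x \<in> d")
    case True
    then show ?thesis using f(2) F(2) permutes_in_image[OF assms(2)] by simp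
  next
    case False
    then have "F x \<notin> d'" using im F(1) by (metis bij_is_inj inj_image_mem_iff)
    then show ?thesis
      using False permutes_not_in[OF assms(2)] permutes_not_in[OF assms(4)] by simp
  qed
  have "v = F \<circ> w \<circ> inv F"
  proof
    fix y
    show "v y = (F \<circ> w \<circ> inv F) y"
      using comm[of "inv F y"] F(1) by (simp add: bij_is_surj surj_f_inv_f)
  qed
  with F(1) im show ?thesis by blast
qed

section \<open>Permutations of given cycle type\<close>

text \<open>A single cycle on a block of consecutive numbers; such blocks, placed one after the other, realise
  any prescribed cycle type.\<close>

lemma ex_cycle_on_interval:
  assumes "0 < m"
  shows "\<exists>v. v permutes {n+1..n+m} \<and> orbit v (n + 1 :: nat) = {n+1..n+m}"
proof -
  let ?S = "{n+1..n+m}"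
  define v where "v = (\<lambda>x. if x \<in> ?S then if x = n + m then n + 1 else x + 1 else x)"
  have inj: "inj_on v ?S" by (auto simp: inj_on_def v_def split: if_splits)
  have into: "v ` ?S \<subseteq> ?S" using assms by (auto simp: v_def)
  have "v ` ?S = ?S" using into inj by (simp add: endo_inj_surj)
  then have v: "v permutes ?S"
    using inj by (intro bij_imp_permutes) (auto simp: bij_betw_def v_def)
  have pow: "n + 1 + i \<in> orbit v (n + 1)" if "i < m" for i
    using that
  proof (induction i)
    case 0
    then show ?case using self_in_orbit[OF v] by simp
  next
    case (Suc i)
    have "v (n + 1 + i) = n + 1 + Suc i" using Suc.prems by (simp add: v_def)
    then show ?case using Suc orbit.step[of "n + 1 + i" v "n + 1"] by simp
  qed
  have "?S \<subseteq> orbit v (n + 1)"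
  proof
    fix x assume "x \<in> ?S"
    then show "x \<in> orbit v (n + 1)" using pow[of "x - (n + 1)"] by auto
  qed
  moreover have "orbit v (n + 1) \<subseteq> ?S" using assms by (intro permutes_orbit_subset[OF v]) simp
  ultimately show ?thesis using v by blast
qed

lemma ex_permutation_of_cycle_type:
  assumes "0 \<notin># R"
  shows "\<exists>w. w permutes {1..sum_mset R} \<and> cycle_type {1..sum_mset R} w = R"
  using assms
proof (induction R)
  case empty
  then show ?case by (auto intro!: exI[of _ id])
next
  case (add m R)
  let ?n = "sum_mset R"
  let ?A = "{1..?n}" and ?B = "{?n+1..?n+m}"
  obtain w where w: "w permutes ?A" "cycle_type ?A w = R" using add by auto
  have "0 < m" using add.prems by simp
  then obtain v where v: "v permutes ?B" "orbit v (?n + 1) = ?B"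
    using ex_cycle_on_interval by blast
  have all: "{1..sum_mset (add_mset m R)} = ?A \<union> ?B" by auto
  have u: "w \<circ> v permutes ?A \<union> ?B"
    by (rule permutes_compose) (use w v in \<open>auto intro: permutes_subset\<close>)
  have onA: "orbit (w \<circ> v) x = orbit w x" if "x \<in> ?A" for x
  proof (rule orbit_cong0[OF that, symmetric])
    show "w \<in> ?A \<rightarrow> ?A" using permutes_in_image[OF w(1)] by blast
    show "w y = (w \<circ> v) y" if "y \<in> ?A" for y
      using permutes_not_in[OF v(1), of y] that by simp
  qed
  have onB: "orbit (w \<circ> v) x = ?B" if "x \<in> ?B" for x
  proof -
    have "orbit (w \<circ> v) x = orbit v x"
    proof (rule orbit_cong0[OF that, symmetric])
      show "v \<in> ?B \<rightarrow> ?B" using permutes_in_image[OF v(1)] by blast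
      show "v y = (w \<circ> v) y" if "y \<in> ?B" for y
        using permutes_in_image[OF v(1), of y] that permutes_not_in[OF w(1), of "v y"] by simp
    qed
    also have "\<dots> = ?B" using orbit_eq_of_mem[OF v(1), of x "?n + 1"] that v(2) by simp
    finally show ?thesis .
  qed
  have "cycle_type (?A \<union> ?B) (w \<circ> v) = cycle_type ?A (w \<circ> v) + cycle_type ?B (w \<circ> v)"
    by (rule cycle_type_Un) (use onA onB permutes_orbit_subset[OF w(1)] in auto)
  also have "cycle_type ?A (w \<circ> v) = R" using cycle_type_cong[of ?A "w \<circ> v" w] onA w(2) by simp
  also have "cycle_type ?B (w \<circ> v) = {#m#}"
  proof -
    have "orbit (w \<circ> v) ` ?B = {?B}" using onB \<open>0 < m\<close> by fastforce
    then show ?thesis by (simp add: cycle_type_def)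
  qed
  finally show ?case using u all by auto
qed

section \<open>Partial permutations\<close>

definition partial_perms :: "nat set \<Rightarrow> young \<Rightarrow> (nat set \<times> (nat \<Rightarrow> nat)) set" where
  "partial_perms X D = {(d, w). d \<subseteq> X \<and> w permutes d \<and> cycle_type d w = rows D}"

lemma partial_perms_subset: "partial_perms X D \<subseteq> Sigma (Pow X) (\<lambda>d. {w. w permutes d})"
  by (auto simp: partial_perms_def)

lemma finite_Sigma_permutes: "finite X \<Longrightarrow> finite (Sigma (Pow X) (\<lambda>d. {w. w permutes d}))"
  by (rule finite_SigmaI) (auto intro: finite_permutations finite_subset)

lemma finite_partial_perms: "finite X \<Longrightarrow> finite (partial_perms X D)"
  by (rule finite_subset[OF partial_perms_subset finite_Sigma_permutes])

lemma permutes_of_partial_perms: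
  assumes "(d, w) \<in> partial_perms X D" "d \<subseteq> e"
  shows "w permutes e"
proof (rule permutes_subset)
  show "w permutes d" using assms(1) by (simp add: partial_perms_def)
qed fact

lemma finite_domain: "(d, w) \<in> partial_perms X D \<Longrightarrow> finite X \<Longrightarrow> finite d"
  by (auto simp: partial_perms_def intro: finite_subset)

lemma card_domain_partial_perms:
  assumes "(d, w) \<in> partial_perms X D" "finite X"
  shows "card d = ydeg D"
  using sum_mset_cycle_type[of w d] finite_domain[OF assms] assms(1)
  by (simp add: partial_perms_def ydeg_def)

lemma ydeg_pos: "0 < ydeg D"
proof -
  obtain m where "m \<in># rows D" "m \<noteq> 0" using rows[of D] by (metis (mono_tags) mem_Collect_eq multiset_nonemptyE)
  then show ?thesis by (auto simp: ydeg_def dest: multi_member_split)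
qed

lemma diagram_of_cycle_type:
  assumes "w permutes d" "finite d" "d \<noteq> {}"
  shows "\<exists>D. rows D = cycle_type d w"
proof
  have "cycle_type d w \<in> {M. M \<noteq> {#} \<and> 0 \<notin># M}"
    using assms by (simp add: cycle_type_eq_empty_iff zero_notin_cycle_type)
  then show "rows (Abs_young (cycle_type d w)) = cycle_type d w" by (rule Abs_young_inverse)
qed

lemma ex_permutation_of_diagram:
  "\<exists>w. w permutes {1..ydeg D} \<and> cycle_type {1..ydeg D} w = rows D"
  using ex_permutation_of_cycle_type[of "rows D"] rows[of D] by (simp add: ydeg_def)

text \<open>The ways to write the partial permutation \<open>(d, g)\<close> as a product of partial permutations of
  diagrams \<open>D1\<close> and \<open>D2\<close>. Requiring the domains to cover \<open>d\<close> keeps track of the fixed points: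
  otherwise the pairs that produce \<open>(d, g)\<close> would also be counted for larger domains.\<close>

definition factorizations ::
  "young \<Rightarrow> young \<Rightarrow> nat set \<Rightarrow> (nat \<Rightarrow> nat) \<Rightarrow>
    ((nat set \<times> (nat \<Rightarrow> nat)) \<times> (nat set \<times> (nat \<Rightarrow> nat))) set" where
  "factorizations D1 D2 d g = {(p, q). p \<in> partial_perms d D1 \<and> q \<in> partial_perms d D2 \<and>
     fst p \<union> fst q = d \<and> snd p \<circ> snd q = g}"

lemma finite_factorizations: "finite d \<Longrightarrow> finite (factorizations D1 D2 d g)"
  by (rule finite_subset[of _ "partial_perms d D1 \<times> partial_perms d D2"])
    (auto simp: factorizations_def intro: finite_partial_perms)

lemma inj_conjugate:
  assumes "bij F" "F \<circ> w \<circ> inv F = F \<circ> w' \<circ> inv F"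
  shows "w = w'"
proof
  fix x
  have "F (w (inv F (F x))) = F (w' (inv F (F x)))"
    using fun_cong[OF assms(2), of "F x"] by simp
  then show "w x = w' x" using assms(1) by (simp add: bij_is_inj inj_eq)
qed

lemma conjugate_partial_perms:
  assumes "bij F" "(d, w) \<in> partial_perms X D" "finite X"
  shows "(F ` d, F \<circ> w \<circ> inv F) \<in> partial_perms (F ` X) D"
  using assms(1,2) permutes_conjugate[of F w d] cycle_type_conjugate[of F w d]
    finite_domain[OF assms(2,3)]
  by (simp add: partial_perms_def image_mono)

lemma card_factorizations_conjugate_le:
  assumes F: "bij F" and d: "finite d"
  shows "card (factorizations D1 D2 d g) \<le> card (factorizations D1 D2 (F ` d) (F \<circ> g \<circ> inv F))"
proof (rule card_inj_on_le)
  let ?c = "\<lambda>(d, w). (F ` d, F \<circ> w \<circ> inv F)"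
  have c: "inj ?c"
  proof (rule injI)
    fix x y :: "nat set \<times> (nat \<Rightarrow> nat)"
    assume eq: "?c x = ?c y"
    obtain d w d' w' where xy: "x = (d, w)" "y = (d', w')" by (cases x, cases y)
    have "F ` d = F ` d'" and w: "F \<circ> w \<circ> inv F = F \<circ> w' \<circ> inv F"
      using eq unfolding xy by (simp_all only: prod.case prod.inject)
    then have "d = d'" using inj_image_eq_iff[OF bij_is_inj[OF F]] by blast
    with inj_conjugate[OF F w] show "x = y" by (simp add: xy)
  qed
  have "inj (map_prod ?c ?c)" by (rule prod.inj_map[OF c c])
  then show "inj_on (map_prod ?c ?c) (factorizations D1 D2 d g)"
    by (rule inj_on_subset) simp
  show "map_prod ?c ?c ` factorizations D1 D2 d g
      \<subseteq> factorizations D1 D2 (F ` d) (F \<circ> g \<circ> inv F)"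
  proof
    fix z assume "z \<in> map_prod ?c ?c ` factorizations D1 D2 d g"
    then obtain d1 a d2 b where z: "z = ((F ` d1, F \<circ> a \<circ> inv F), (F ` d2, F \<circ> b \<circ> inv F))"
      and p: "(d1, a) \<in> partial_perms d D1" and q: "(d2, b) \<in> partial_perms d D2"
      and u: "d1 \<union> d2 = d" "a \<circ> b = g"
      by (auto simp: factorizations_def)
    have "(F \<circ> a \<circ> inv F) \<circ> (F \<circ> b \<circ> inv F) = F \<circ> g \<circ> inv F"
      using F u(2) by (auto simp: fun_eq_iff bij_is_inj inv_f_f)
    moreover have "F ` d1 \<union> F ` d2 = F ` d" using u(1) by blast
    ultimately show "z \<in> factorizations D1 D2 (F ` d) (F \<circ> g \<circ> inv F)"
      using conjugate_partial_perms[OF F p d] conjugate_partial_perms[OF F q d]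
      by (simp add: factorizations_def z)
  qed
  show "finite (factorizations D1 D2 (F ` d) (F \<circ> g \<circ> inv F))"
    using d by (simp add: finite_factorizations)
qed

lemma card_factorizations_conjugate:
  assumes F: "bij F" and d: "finite d"
  shows "card (factorizations D1 D2 (F ` d) (F \<circ> g \<circ> inv F)) = card (factorizations D1 D2 d g)"
proof (rule antisym)
  have "inv F ` F ` d = d" using F by (simp add: bij_is_inj)
  moreover have "inv F \<circ> (F \<circ> g \<circ> inv F) \<circ> inv (inv F) = g"
    using F by (auto simp: fun_eq_iff bij_is_inj inv_inv_eq)
  ultimately show "card (factorizations D1 D2 (F ` d) (F \<circ> g \<circ> inv F))
      \<le> card (factorizations D1 D2 d g)"
    using card_factorizations_conjugate_le[OF bij_imp_bij_inv[OF F], of "F ` d" D1 D2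
        "F \<circ> g \<circ> inv F"] d by simp
qed (rule card_factorizations_conjugate_le[OF F d])

text \<open>The structure constants of the product, computed with a representative of the diagram \<open>D\<close> on
  \<open>{1..ydeg D}\<close>; by \<open>card_factorizations\<close> below any other representative gives the same number.\<close>

definition factorization_number :: "young \<Rightarrow> young \<Rightarrow> young \<Rightarrow> nat" where
  "factorization_number D1 D2 D = card (factorizations D1 D2 {1..ydeg D}
     (SOME g. g permutes {1..ydeg D} \<and> cycle_type {1..ydeg D} g = rows D))"

lemma card_factorizations:
  assumes "finite d" "g permutes d" "cycle_type d g = rows D"
  shows "card (factorizations D1 D2 d g) = factorization_number D1 D2 D"
proof -
  let ?g = "SOME g. g permutes {1..ydeg D} \<and> cycle_type {1..ydeg D} g = rows D"
  have "?g permutes {1..ydeg D} \<and> cycle_type {1..ydeg D} ?g = rows D"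
    using ex_permutation_of_diagram[of D] by (rule someI_ex)
  then obtain F where "bij F" "F ` d = {1..ydeg D}" "?g = F \<circ> g \<circ> inv F"
    using conjugate_if_same_cycle_type[OF assms(1,2), of "{1..ydeg D}" ?g] assms(3) by auto
  then show ?thesis
    using card_factorizations_conjugate[of F d D1 D2 g] assms(1)
    by (simp add: factorization_number_def)
qed

lemma ydeg_bounds_of_factorization_number:
  assumes "factorization_number D1 D2 D \<noteq> 0"
  shows "max (ydeg D1) (ydeg D2) \<le> ydeg D" "ydeg D \<le> ydeg D1 + ydeg D2"
proof -
  let ?d = "{1..ydeg D}"
  obtain d1 a d2 b where
    p: "(d1, a) \<in> partial_perms ?d D1" and q: "(d2, b) \<in> partial_perms ?d D2"
    and u: "d1 \<union> d2 = ?d"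
  proof -
    have "factorizations D1 D2 ?d (SOME g. g permutes ?d \<and> cycle_type ?d g = rows D) \<noteq> {}"
      using assms unfolding factorization_number_def by (metis card.empty)
    then obtain p q where "p \<in> partial_perms ?d D1" "q \<in> partial_perms ?d D2" "fst p \<union> fst q = ?d"
      unfolding factorizations_def by blast
    then show thesis using that[of "fst p" "snd p" "fst q" "snd q"] by simp
  qed
  have "card d1 = ydeg D1" "card d2 = ydeg D2"
    using card_domain_partial_perms[OF p] card_domain_partial_perms[OF q] by auto
  moreover have "card d1 \<le> card ?d" "card d2 \<le> card ?d"
    using u by (metis card_mono finite_atLeastAtMost sup_ge1 sup_ge2)+
  moreover have "card ?d \<le> card d1 + card d2"
    unfolding u[symmetric] by (rule card_Un_le)
  ultimately show "max (ydeg D1) (ydeg D2) \<le> ydeg D" "ydeg D \<le> ydeg D1 + ydeg D2"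
    by auto
qed

text \<open>The map \<open>((d1, a), (d2, b)) \<mapsto> ((a d2, a \<circ> b \<circ> inv a), (d1, a))\<close> exchanges the two diagrams and
  keeps the product. The union of the domains is kept too, because \<open>a\<close> maps \<open>d1\<close> and \<open>d = d1 \<union> d2\<close>
  onto themselves.\<close>

lemma card_factorizations_commute_le:
  assumes d: "finite d"
  shows "card (factorizations D1 D2 d g) \<le> card (factorizations D2 D1 d g)"
proof (rule card_inj_on_le)
  let ?s = "\<lambda>((d1, a), (d2, b)). ((a ` d2, a \<circ> b \<circ> inv a), (d1 :: nat set, a :: nat \<Rightarrow> nat))"
  have bij: "bij a" if "((d1, a), q) \<in> factorizations D1 D2 d g" for d1 a q
    using that permutes_bij by (auto simp: factorizations_def partial_perms_def)
  show "inj_on ?s (factorizations D1 D2 d g)"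
  proof (rule inj_onI)
    fix x y
    assume x: "x \<in> factorizations D1 D2 d g" and xy: "?s x = ?s y"
    obtain d1 a d2 b d1' a' d2' b'
      where pairs: "x = ((d1, a), (d2, b))" "y = ((d1', a'), (d2', b'))"
      by (cases x, cases y) auto
    have mem: "((d1, a), (d2, b)) \<in> factorizations D1 D2 d g" using x pairs by simp
    have eq: "a ` d2 = a' ` d2'" "a \<circ> b \<circ> inv a = a' \<circ> b' \<circ> inv a'" "a = a'"
      and d: "d1 = d1'"
      using xy unfolding pairs prod.case prod.inject by blast+
    have "d2 = d2'" using eq(1,3) bij[OF mem] by (simp add: bij_is_inj inj_image_eq_iff)
    moreover have "b = b'" using eq(2,3) inj_conjugate[OF bij[OF mem]] by simp
    ultimately show "x = y" using eq(3) d by (simp add: pairs)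
  qed
  show "?s ` factorizations D1 D2 d g \<subseteq> factorizations D2 D1 d g"
  proof clarify
    fix d1 a d2 b assume mem: "((d1, a), (d2, b)) \<in> factorizations D1 D2 d g"
    then have p: "(d1, a) \<in> partial_perms d D1" and q: "(d2, b) \<in> partial_perms d D2"
      and u: "d1 \<union> d2 = d" "a \<circ> b = g"
      by (auto simp: factorizations_def)
    have a: "a permutes d1" "a permutes d"
      using permutes_of_partial_perms[OF p] u(1) by auto
    have "(a ` d2, a \<circ> b \<circ> inv a) \<in> partial_perms d D2"
      using conjugate_partial_perms[OF bij[OF mem] q d] permutes_image[OF a(2)] by simp
    moreover have "a ` d2 \<union> d1 = d"
      using u(1) permutes_image[OF a(1)] permutes_image[OF a(2)] by blast
    moreover have "(a \<circ> b \<circ> inv a) \<circ> a = g"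
      using u(2) bij[OF mem] by (simp add: comp_assoc bij_is_inj)
    ultimately show "((a ` d2, a \<circ> b \<circ> inv a), (d1, a)) \<in> factorizations D2 D1 d g"
      using p by (simp add: factorizations_def)
  qed
qed (rule finite_factorizations[OF d])

lemma factorization_number_commute:
  "factorization_number D1 D2 D = factorization_number D2 D1 D"
  unfolding factorization_number_def
  by (intro antisym card_factorizations_commute_le) auto

section \<open>The images in the group algebras\<close>

text \<open>The image of the sum of all partial permutations of diagram \<open>D\<close> with domain in \<open>{1..n}\<close> under
  the map that forgets domains.\<close>

definition partial_class_sum :: "nat \<Rightarrow> young \<Rightarrow> ((nat \<Rightarrow> nat) \<Rightarrow>\<^sub>0 complex)" where
  "partial_class_sum n D = (\<Sum>(d, w)\<in>partial_perms {1..n} D. basis_vec w)"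

lemma partial_perms_empty:
  assumes "n < ydeg D"
  shows "partial_perms {1..n} D = {}"
proof (rule ccontr)
  assume "partial_perms {1..n} D \<noteq> {}"
  then obtain d w where mem: "(d, w) \<in> partial_perms {1..n} D" by auto
  then have "d \<subseteq> {1..n}" by (simp add: partial_perms_def)
  then have "card d \<le> n" using card_mono[of "{1..n}" d] by simp
  then show False using card_domain_partial_perms[OF mem] assms by simp
qed

lemma partial_class_sum_0: "n < ydeg D \<Longrightarrow> partial_class_sum n D = 0"
  using partial_perms_empty[of n D] by (simp add: partial_class_sum_def)

lemma finite_diagrams_le: "finite {D. ydeg D \<le> n}"
proof -
  have "{D. ydeg D \<le> n} = (\<Union>k\<le>n. diagrams k)" by (auto simp: diagrams_def)
  then show ?thesis by (simp add: finite_diagrams)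
qed

text \<open>Multiply out, group the pairs by their product \<open>(d, g)\<close> as partial permutations, and then group
  these by their diagram. The coefficients are independent of \<open>n\<close>, which is what makes a single
  product on the direct sum compatible with all group algebras. The set \<open>S\<close> is left open, so
  that the sum can be restricted to the degrees at hand.\<close>

lemma galg_mult_partial_class_sum:
  assumes S: "finite S" "{D. factorization_number D1 D2 D \<noteq> 0 \<and> ydeg D \<le> n} \<subseteq> S"
  shows "galg_mult (partial_class_sum n D1) (partial_class_sum n D2) =
    (\<Sum>D\<in>S. cscale (of_nat (factorization_number D1 D2 D)) (partial_class_sum n D))"
proof -
  let ?P = "partial_perms {1..n}" and ?N = "factorization_number D1 D2"
  let ?T = "Sigma (Pow {1..n}) (\<lambda>d. {w. w permutes d})"
  let ?u = "\<lambda>(p, q). (fst p \<union> fst q, snd p \<circ> snd q) :: nat set \<times> (nat \<Rightarrow> nat)"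
  let ?h = "\<lambda>(d, w). cscale (of_nat (card (factorizations D1 D2 d w))) (basis_vec w)"
  have T: "finite ?T"
    by (rule finite_Sigma_permutes) simp
  have P: "finite (?P D)" for D by (simp add: finite_partial_perms)
  have "galg_mult (partial_class_sum n D1) (partial_class_sum n D2) =
      (\<Sum>p\<in>?P D1. \<Sum>q\<in>?P D2. basis_vec (snd p \<circ> snd q))"
    unfolding galg_mult_def partial_class_sum_def bilinear_ext_sum_left
    by (simp add: bilinear_ext_sum_right case_prod_unfold)
  also have "\<dots> = (\<Sum>x\<in>?P D1 \<times> ?P D2. basis_vec (snd (?u x)))"
    by (simp add: sum.cartesian_product case_prod_unfold)
  also have "\<dots> = (\<Sum>y\<in>?T. \<Sum>x\<in>{x \<in> ?P D1 \<times> ?P D2. ?u x = y}. basis_vec (snd (?u x)))"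
  proof (rule sum.group[symmetric])
    show "?u ` (?P D1 \<times> ?P D2) \<subseteq> ?T"
    proof
      fix y assume "y \<in> ?u ` (?P D1 \<times> ?P D2)"
      then obtain d1 a d2 b where p: "(d1, a) \<in> ?P D1" and q: "(d2, b) \<in> ?P D2"
        and y: "y = (d1 \<union> d2, a \<circ> b)"
        by force
      have "a \<circ> b permutes d1 \<union> d2"
        by (rule permutes_compose) (auto intro: permutes_of_partial_perms[OF p]
            permutes_of_partial_perms[OF q])
      moreover have "d1 \<union> d2 \<subseteq> {1..n}" using p q by (auto simp: partial_perms_def)
      ultimately show "y \<in> ?T" by (simp add: y)
    qed
  qed (use T P in auto)
  also have "\<dots> = (\<Sum>y\<in>?T. ?h y)"
  proof (rule sum.cong[OF refl], clarify)
    fix d w assume d: "d \<subseteq> {1..n}"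
    have "{x \<in> ?P D1 \<times> ?P D2. ?u x = (d, w)} = factorizations D1 D2 d w"
      using d by (auto simp: factorizations_def partial_perms_def)
    then have "(\<Sum>x\<in>{x \<in> ?P D1 \<times> ?P D2. ?u x = (d, w)}. basis_vec (snd (?u x))) =
        (\<Sum>x\<in>factorizations D1 D2 d w. basis_vec w)"
      by (intro sum.cong) (auto simp: factorizations_def)
    also have "\<dots> = ?h (d, w)"
      by (auto intro!: poly_mapping_eqI simp: lookup_sum)
    finally show "(\<Sum>x\<in>{x \<in> ?P D1 \<times> ?P D2. ?u x = (d, w)}. basis_vec (snd (?u x))) =
      cscale (of_nat (card (factorizations D1 D2 d w))) (basis_vec w)" by simp
  qed
  also have "\<dots> = (\<Sum>y\<in>(\<Union>D\<in>{D. ydeg D \<le> n}. ?P D). ?h y)"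
  proof (rule sum.mono_neutral_right[OF T])
    show "(\<Union>D\<in>{D. ydeg D \<le> n}. ?P D) \<subseteq> ?T" by (auto simp: partial_perms_def)
    show "\<forall>y\<in>?T - (\<Union>D\<in>{D. ydeg D \<le> n}. ?P D). ?h y = 0"
    proof (rule ballI, rule ccontr)
      fix y assume y: "y \<in> ?T - (\<Union>D\<in>{D. ydeg D \<le> n}. ?P D)" and nz: "?h y \<noteq> 0"
      obtain d w where dw: "y = (d, w)" by (cases y)
      have d: "d \<subseteq> {1..n}" "w permutes d" using y dw by auto
      have "factorizations D1 D2 d w \<noteq> {}" using nz dw by auto
      then obtain d1 a where "(d1, a) \<in> partial_perms d D1" by (auto simp: factorizations_def)
      moreover have fin: "finite d" by (rule finite_subset[OF d(1)]) simp
      \<comment> \<open>The empty partial permutation has no diagram. It is not a product either, as diagrams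
        have positive degree.\<close>
      ultimately have "d \<noteq> {}"
        using card_domain_partial_perms[of d1 a d D1] ydeg_pos[of D1]
        by (auto simp: partial_perms_def)
      then obtain D where "rows D = cycle_type d w"
        using diagram_of_cycle_type[OF d(2) fin] by blast
      then have mem: "(d, w) \<in> ?P D"
        using d by (simp add: partial_perms_def)
      then have "ydeg D \<le> n" using partial_perms_empty[of n D] by (metis empty_iff not_le)
      then have "y \<in> (\<Union>D\<in>{D. ydeg D \<le> n}. ?P D)" using mem dw by blast
      with y show False unfolding Diff_iff by blast
    qed
  qed
  also have "\<dots> = (\<Sum>D\<in>{D. ydeg D \<le> n}. \<Sum>y\<in>?P D. ?h y)"
  proof (rule sum.UNION_disjoint[OF finite_diagrams_le])
    show "\<forall>D\<in>{D. ydeg D \<le> n}. finite (?P D)" using P by blast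
    have "D = E" if "(d, w) \<in> ?P D" "(d, w) \<in> ?P E" for d w D E
      using that by (simp add: partial_perms_def flip: rows_inject)
    then show "\<forall>D\<in>{D. ydeg D \<le> n}. \<forall>E\<in>{D. ydeg D \<le> n}. D \<noteq> E \<longrightarrow> ?P D \<inter> ?P E = {}"
      by auto
  qed
  also have "\<dots> = (\<Sum>D\<in>{D. ydeg D \<le> n}. cscale (of_nat (?N D)) (partial_class_sum n D))"
  proof (rule sum.cong[OF refl])
    fix D
    have "card (factorizations D1 D2 d w) = ?N D" if "(d, w) \<in> ?P D" for d w
      using that finite_domain[OF that] by (intro card_factorizations) (simp_all add: partial_perms_def)
    then show "(\<Sum>y\<in>?P D. ?h y) = cscale (of_nat (?N D)) (partial_class_sum n D)"
      unfolding partial_class_sum_def cvs.scale_sum_right by (intro sum.cong) auto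
  qed
  also have "\<dots> = (\<Sum>D\<in>S. cscale (of_nat (?N D)) (partial_class_sum n D))"
    using S finite_diagrams_le
    by (intro sum.mono_neutral_cong) (auto intro: ccontr simp: partial_class_sum_0 not_le)
  finally show ?thesis .
qed

lemma lookup_partial_class_sum:
  "Poly_Mapping.lookup (partial_class_sum n D) g = of_nat (card {d. (d, g) \<in> partial_perms {1..n} D})"
proof -
  have "Poly_Mapping.lookup (partial_class_sum n D) g =
      (\<Sum>x\<in>partial_perms {1..n} D. if snd x = g then 1 else 0)"
    by (simp add: partial_class_sum_def lookup_sum case_prod_unfold lookup_basis_vec)
  also have "\<dots> = of_nat (card {x \<in> partial_perms {1..n} D. snd x = g})"
    by (simp add: sum.If_cases finite_partial_perms Int_def)
  also have "{x \<in> partial_perms {1..n} D. snd x = g} =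
      (\<lambda>d. (d, g)) ` {d. (d, g) \<in> partial_perms {1..n} D}" by auto
  finally show ?thesis by (simp add: card_image inj_on_def)
qed

lemma full_domain:
  assumes "(d, w) \<in> partial_perms {1..n} D" "n \<le> ydeg D"
  shows "d = {1..n}"
proof (rule card_seteq)
  show "card {1..n} \<le> card d" using assms card_domain_partial_perms[of d w "{1..n}" D] by simp
qed (use assms in \<open>auto simp: partial_perms_def\<close>)

lemma partial_class_sum_eq_class_sum:
  assumes "ydeg D = n"
  shows "partial_class_sum n D = class_sum n D"
proof -
  have "partial_perms {1..n} D =
      (\<lambda>g. ({1..n}, g)) ` {g. g permutes {1..n} \<and> cycle_lengths n g = rows D}"
    using full_domain[of _ _ n D] assms
    by (auto simp: partial_perms_def cycle_lengths_def cycle_type_def)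
  then show ?thesis
    by (simp add: partial_class_sum_def class_sum_def sum.reindex inj_on_def)
qed

definition to_galg :: "nat \<Rightarrow> A_inf \<Rightarrow> ((nat \<Rightarrow> nat) \<Rightarrow>\<^sub>0 complex)" where
  "to_galg n = linear_ext (partial_class_sum n)"

lemma to_galg_basis_vec [simp]: "to_galg n (basis_vec D) = partial_class_sum n D"
  by (simp add: to_galg_def)

lemma to_galg_linear:
  "to_galg n (x + y) = to_galg n x + to_galg n y" "to_galg n (x - y) = to_galg n x - to_galg n y"
  "to_galg n (cscale c x) = cscale c (to_galg n x)" "to_galg n (\<Sum>i\<in>I. f i) = (\<Sum>i\<in>I. to_galg n (f i))"
  by (simp_all add: to_galg_def linear_ext_add linear_ext_diff linear_ext_cscale linear_ext_sum)

text \<open>Diagrams of degree above \<open>n\<close> have no partial permutation in \<open>{1..n}\<close>, and those of degree \<open>n\<close>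
  only have full ones. So a permutation of \<open>{1..n}\<close> sees only the coefficient of its own diagram.\<close>

lemma lookup_to_galg:
  assumes deg: "\<And>E. E \<in> Poly_Mapping.keys x \<Longrightarrow> n \<le> ydeg E"
    and g: "g permutes {1..n}" "cycle_type {1..n} g = rows D"
  shows "Poly_Mapping.lookup (to_galg n x) g = Poly_Mapping.lookup x D"
proof -
  let ?K = "insert D (Poly_Mapping.keys x)"
  have n: "ydeg D = n" using sum_mset_cycle_type[OF g(1)] g(2) by (simp add: ydeg_def)
  have D: "{d. (d, g) \<in> partial_perms {1..n} E} = (if E = D then {{1..n}} else {})"
    if "E \<in> ?K" for E
  proof -
    have "n \<le> ydeg E" using that deg n by auto
    then have d: "d = {1..n}" if "(d, g) \<in> partial_perms {1..n} E" for d
      using full_domain that by blast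
    have "E = D" if "(d, g) \<in> partial_perms {1..n} E" for d
      using d[OF that] that g(2) by (simp add: partial_perms_def rows_inject)
    moreover have "({1..n}, g) \<in> partial_perms {1..n} D" using g by (simp add: partial_perms_def)
    ultimately have "d \<in> {d. (d, g) \<in> partial_perms {1..n} E} \<longleftrightarrow> E = D \<and> d = {1..n}" for d
      using d by blast
    then have "{d. (d, g) \<in> partial_perms {1..n} E} = {d. E = D \<and> d = {1..n}}" by blast
    then show ?thesis by (cases "E = D") simp_all
  qed
  have coeff: "Poly_Mapping.lookup (partial_class_sum n E) g = (if E = D then 1 else 0)"
    if "E \<in> ?K" for E
    unfolding lookup_partial_class_sum D[OF that] by simp
  have "Poly_Mapping.lookup (to_galg n x) g =
      (\<Sum>E\<in>?K. Poly_Mapping.lookup x E * Poly_Mapping.lookup (partial_class_sum n E) g)"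
    unfolding to_galg_def by (rule lookup_linear_ext) auto
  also have "\<dots> = (\<Sum>E\<in>?K. Poly_Mapping.lookup x E * (if E = D then 1 else 0))"
    by (rule sum.cong[OF refl]) (simp only: coeff)
  finally show ?thesis by (simp add: if_distrib[of "\<lambda>z. _ * z"] cong: if_cong)
qed

text \<open>A nonzero element is detected in its least degree.\<close>

lemma to_galg_jointly_injective:
  assumes "\<And>n. to_galg n x = to_galg n y"
  shows "x = y"
proof (rule ccontr)
  assume "x \<noteq> y"
  then have "Poly_Mapping.keys (x - y) \<noteq> {}" by simp
  then obtain D where D: "D \<in> Poly_Mapping.keys (x - y)"
      "\<And>E. E \<in> Poly_Mapping.keys (x - y) \<Longrightarrow> ydeg D \<le> ydeg E"
    using ex_has_least_nat[of "\<lambda>E. E \<in> Poly_Mapping.keys (x - y)" _ ydeg] by blast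
  obtain g where "g permutes {1..ydeg D}" "cycle_type {1..ydeg D} g = rows D"
    using ex_permutation_of_diagram by blast
  then have "Poly_Mapping.lookup (to_galg (ydeg D) (x - y)) g = Poly_Mapping.lookup (x - y) D"
    using D(2) by (intro lookup_to_galg) auto
  moreover have "to_galg (ydeg D) (x - y) = 0" using assms by (simp add: to_galg_linear)
  ultimately show False using D(1) by (simp add: in_keys_iff)
qed

definition homogeneous :: "nat \<Rightarrow> A_inf \<Rightarrow> bool" where
  "homogeneous n x \<longleftrightarrow> (\<forall>D. D \<notin> diagrams n \<longrightarrow> Poly_Mapping.lookup x D = 0)"

lemma homogeneous_basis_vec: "homogeneous n (basis_vec D) \<longleftrightarrow> D \<in> diagrams n"
  by (auto simp: homogeneous_def lookup_basis_vec)

lemma homogeneous_cscale: "homogeneous n x \<Longrightarrow> homogeneous n (cscale c x)"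
  by (simp add: homogeneous_def)

lemma homogeneous_diff: "homogeneous n x \<Longrightarrow> homogeneous n y \<Longrightarrow> homogeneous n (x - y)"
  by (simp add: homogeneous_def lookup_minus)

lemma homogeneous_sum: "(\<And>i. i \<in> I \<Longrightarrow> homogeneous n (f i)) \<Longrightarrow> homogeneous n (\<Sum>i\<in>I. f i)"
  by (simp add: homogeneous_def lookup_sum)

lemma to_galg_injective_homogeneous:
  assumes x: "homogeneous n x" and y: "homogeneous n y" and eq: "to_galg n x = to_galg n y"
  shows "x = y"
proof (rule poly_mapping_eqI)
  fix D
  show "Poly_Mapping.lookup x D = Poly_Mapping.lookup y D"
  proof (cases "D \<in> diagrams n")
    case True
    then obtain g where g: "g permutes {1..n}" "cycle_type {1..n} g = rows D"
      using ex_permutation_of_diagram[of D] by (auto simp: diagrams_def)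
    have "Poly_Mapping.lookup (to_galg n z) g = Poly_Mapping.lookup z D" if "homogeneous n z" for z
      by (rule lookup_to_galg[OF _ g])
        (use that in \<open>auto simp: homogeneous_def in_keys_iff diagrams_def\<close>)
    then show ?thesis using x y eq by metis
  next
    case False
    then show ?thesis using x y by (simp add: homogeneous_def)
  qed
qed

section \<open>The product by counting factorizations\<close>

text \<open>The closed form of \<open>brace D1 D2 n\<close> for \<open>n \<ge> max (ydeg D1) (ydeg D2)\<close>, as
  \<open>brace_eq_product_part\<close> shows.\<close>

definition product_part :: "young \<Rightarrow> young \<Rightarrow> nat \<Rightarrow> A_inf" where
  "product_part D1 D2 n =
    (\<Sum>D\<in>diagrams n. cscale (of_nat (factorization_number D1 D2 D)) (basis_vec D))"

lemma homogeneous_product_part: "homogeneous n (product_part D1 D2 n)"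
  by (simp add: product_part_def homogeneous_sum homogeneous_cscale homogeneous_basis_vec)

lemma sum_product_part:
  assumes "finite K"
  shows "(\<Sum>k\<in>K. product_part D1 D2 k) =
    (\<Sum>D\<in>(\<Union>k\<in>K. diagrams k). cscale (of_nat (factorization_number D1 D2 D)) (basis_vec D))"
  unfolding product_part_def
  by (rule sum.UNION_disjoint[symmetric])
    (auto simp: assms finite_diagrams, auto simp: diagrams_def)

lemma galg_mult_eq_to_galg_product_parts:
  assumes "finite K" "{max (ydeg D1) (ydeg D2)..min n (ydeg D1 + ydeg D2)} \<subseteq> K"
  shows "galg_mult (partial_class_sum n D1) (partial_class_sum n D2) =
    to_galg n (\<Sum>k\<in>K. product_part D1 D2 k)"
proof -
  have "{D. factorization_number D1 D2 D \<noteq> 0 \<and> ydeg D \<le> n} \<subseteq> (\<Union>k\<in>K. diagrams k)"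
    using assms(2) ydeg_bounds_of_factorization_number[of D1 D2] by (fastforce simp: diagrams_def)
  then show ?thesis
    using assms(1) unfolding sum_product_part[OF assms(1)]
    by (simp add: to_galg_linear galg_mult_partial_class_sum finite_diagrams)
qed

text \<open>A partial permutation in \<open>{1..n}\<close> with a diagram of degree \<open>n\<close> is a permutation of \<open>{1..n}\<close>,
  so the structure constants of the centre of the group algebra are factorization numbers.
  Uniqueness is the linear independence of the class sums.\<close>

lemma structure_const_eq:
  assumes "ydeg D1 = n" "ydeg D2 = n"
  shows "structure_const n D1 D2 =
    (\<lambda>D. if D \<in> diagrams n then of_nat (factorization_number D1 D2 D) else 0)"
  unfolding structure_const_def
proof (rule the_equality)
  let ?C = "\<lambda>D. if D \<in> diagrams n then of_nat (factorization_number D1 D2 D) else 0 :: complex"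
  let ?v = "\<lambda>C :: young \<Rightarrow> complex. \<Sum>D\<in>diagrams n. cscale (C D) (basis_vec D)"
  let ?G = "galg_mult (class_sum n D1) (class_sum n D2)"
  have cls: "(\<Sum>D\<in>diagrams n. cscale (C D) (class_sum n D)) = to_galg n (?v C)" for C
    by (auto simp: to_galg_linear diagrams_def partial_class_sum_eq_class_sum intro!: sum.cong)
  have vC: "?v ?C = product_part D1 D2 n" by (simp add: product_part_def)
  have G: "?G = to_galg n (?v ?C)"
    unfolding vC using galg_mult_eq_to_galg_product_parts[of "{n}" D1 D2 n] assms
    by (simp add: partial_class_sum_eq_class_sum)
  then show "(\<forall>D. D \<notin> diagrams n \<longrightarrow> ?C D = 0) \<and>
      ?G = (\<Sum>D\<in>diagrams n. cscale (?C D) (class_sum n D))"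
    unfolding cls by simp
  fix C :: "young \<Rightarrow> complex"
  assume C: "(\<forall>D. D \<notin> diagrams n \<longrightarrow> C D = 0) \<and>
      ?G = (\<Sum>D\<in>diagrams n. cscale (C D) (class_sum n D))"
  have hom: "homogeneous n (?v C)" for C
    by (simp add: homogeneous_sum homogeneous_cscale homogeneous_basis_vec)
  have "to_galg n (?v C) = to_galg n (?v ?C)" using C G cls by metis
  then have "?v C = ?v ?C" by (rule to_galg_injective_homogeneous[OF hom hom])
  moreover have lookup: "Poly_Mapping.lookup (?v C) D = C D" if "D \<in> diagrams n" for C D
    using that by (simp add: lookup_sum lookup_basis_vec finite_diagrams
        if_distrib[of "\<lambda>z. _ * z"] cong: if_cong)
  ultimately have eq: "C D = ?C D" if "D \<in> diagrams n" for D
    using lookup[OF that, of C] lookup[OF that, of ?C] by (simp only:)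
  show "C = ?C"
  proof
    show "C D = ?C D" for D using eq[of D] C by (cases "D \<in> diagrams n") simp_all
  qed
qed

lemma homogeneous_circ: "homogeneous n (circ n x y)"
proof -
  have lin: "homogeneous n (linear_ext f z)" if "\<And>a. homogeneous n (f a)" for f :: "young \<Rightarrow> A_inf" and z
    unfolding linear_ext_def using that by (intro homogeneous_sum homogeneous_cscale)
  show ?thesis unfolding circ_def bilinear_ext_def
    by (intro lin homogeneous_sum homogeneous_cscale) (simp add: homogeneous_basis_vec)
qed

lemma to_galg_circ:
  assumes "ydeg D1 = n" "ydeg D2 = n"
  shows "to_galg n (circ n (cscale a (basis_vec D1)) (cscale b (basis_vec D2))) =
    galg_mult (to_galg n (cscale a (basis_vec D1))) (to_galg n (cscale b (basis_vec D2)))"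
proof -
  have "to_galg n (circ n (basis_vec D1) (basis_vec D2)) =
      galg_mult (partial_class_sum n D1) (partial_class_sum n D2)"
    using galg_mult_eq_to_galg_product_parts[of "{n}" D1 D2 n] assms
    by (simp add: circ_def structure_const_eq product_part_def)
  then show ?thesis
    by (simp add: circ_def galg_mult_def bilinear_ext_linear to_galg_linear)
qed

lemma ydeg_add_unit_rows: "ydeg (add_unit_rows k D) = ydeg D + k"
  by (simp add: ydeg_def add_unit_rows.rep_eq)

lemma rho_basis_vec:
  "rho k (basis_vec D) =
    cscale (of_nat ((count (rows D) 1 + k) choose k)) (basis_vec (add_unit_rows k D))"
  by (simp add: rho_def Let_def binomial_fact mult.commute)

text \<open>On the right, a permutation is counted once for each of its restrictions to a set of diagram \<open>D\<close>;
  on the left, it occurs with the binomial coefficient of \<open>rho\<close> if its diagram is \<open>D\<close> with rows of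
  length 1 added. Both numbers agree by \<open>card_invariant_subsets_of_cycle_type\<close>.\<close>

lemma to_galg_rho_basis_vec:
  assumes "ydeg D \<le> n"
  shows "to_galg n (rho (n - ydeg D) (basis_vec D)) = partial_class_sum n D"
proof (rule poly_mapping_eqI)
  fix g
  let ?k = "n - ydeg D" and ?X = "{1..n}"
  let ?E = "add_unit_rows ?k D"
  have E: "ydeg ?E = n" "rows ?E = rows D + replicate_mset ?k 1"
    using assms by (simp_all add: ydeg_add_unit_rows add_unit_rows.rep_eq)
  have cls: "Poly_Mapping.lookup (partial_class_sum n ?E) g =
      (if g permutes ?X \<and> cycle_type ?X g = rows ?E then 1 else 0)"
  proof -
    have "{d. (d, g) \<in> partial_perms ?X ?E} =
        (if g permutes ?X \<and> cycle_type ?X g = rows ?E then {?X} else {})"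
      using full_domain[of _ g n ?E] E(1) by (auto simp: partial_perms_def)
    then show ?thesis by (simp add: lookup_partial_class_sum)
  qed
  show "Poly_Mapping.lookup (to_galg n (rho ?k (basis_vec D))) g =
      Poly_Mapping.lookup (partial_class_sum n D) g"
  proof (cases "g permutes ?X \<and> cycle_type ?X g = rows ?E")
    case True
    then have "card {d. d \<subseteq> ?X \<and> g permutes d \<and> cycle_type d g = rows D} =
        (count (rows D) 1 + ?k) choose ?k"
      using E(2) by (intro card_invariant_subsets_of_cycle_type) auto
    then show ?thesis using True
      by (simp add: rho_basis_vec to_galg_linear cls lookup_partial_class_sum[of n D] partial_perms_def)
  next
    case False
    have "(d, g) \<notin> partial_perms ?X D" for d
    proof
      assume mem: "(d, g) \<in> partial_perms ?X D"
      then have "card d = ydeg D" by (simp add: card_domain_partial_perms)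
      moreover have "g permutes d" "d \<subseteq> ?X" using mem by (auto simp: partial_perms_def)
      ultimately have "g permutes ?X \<and> cycle_type ?X g = rows ?E"
        using cycle_type_mono[of g d ?X] permutes_subset[of g d ?X] mem E(2)
        by (simp add: partial_perms_def)
      with False show False by blast
    qed
    then show ?thesis using False
      by (simp add: rho_basis_vec to_galg_linear cls lookup_partial_class_sum[of n D])
  qed
qed

lemma rho_product_part:
  assumes "k \<le> n"
  shows "homogeneous n (rho (n - k) (product_part D1 D2 k))"
    and "to_galg n (rho (n - k) (product_part D1 D2 k)) = to_galg n (product_part D1 D2 k)"
proof -
  have rho: "rho (n - k) (product_part D1 D2 k) = (\<Sum>D\<in>diagrams k.
      cscale (of_nat (factorization_number D1 D2 D)) (rho (n - ydeg D) (basis_vec D)))"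
    unfolding product_part_def
    by (simp add: rho_def linear_ext_sum linear_ext_cscale) (simp add: diagrams_def)
  show "homogeneous n (rho (n - k) (product_part D1 D2 k))"
    unfolding rho using assms
    by (auto intro!: homogeneous_sum homogeneous_cscale
        simp: rho_basis_vec homogeneous_basis_vec diagrams_def ydeg_add_unit_rows)
  show "to_galg n (rho (n - k) (product_part D1 D2 k)) = to_galg n (product_part D1 D2 k)"
    unfolding rho unfolding product_part_def to_galg_linear using assms
    by (intro sum.cong) (auto simp: to_galg_rho_basis_vec diagrams_def)
qed

text \<open>Under \<open>to_galg n\<close>, which is injective in degree \<open>n\<close>, the recursion turns into the decomposition of
  \<open>galg_mult (partial_class_sum n D1) (partial_class_sum n D2)\<close> by degree: the terms of degree below
  \<open>n\<close> are subtracted, and the part of degree \<open>n\<close> remains.\<close>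

lemma brace_eq_product_part:
  "max (ydeg D1) (ydeg D2) \<le> n \<Longrightarrow> brace D1 D2 n = product_part D1 D2 n"
proof (induction n rule: less_induct)
  case (less n)
  let ?M = "max (ydeg D1) (ydeg D2)"
  let ?c = "circ n (rho (n - ydeg D1) (basis_vec D1)) (rho (n - ydeg D2) (basis_vec D2))"
  let ?s = "\<Sum>k\<in>{?M..<n}. rho (n - k) (product_part D1 D2 k)"
  have "brace D1 D2 n = ?c - ?s"
    using less.IH by (subst brace.simps) simp
  moreover have "?c - ?s = product_part D1 D2 n"
  proof (rule to_galg_injective_homogeneous)
    show "homogeneous n (?c - ?s)"
      by (intro homogeneous_diff homogeneous_circ homogeneous_sum rho_product_part(1)) auto
    show "homogeneous n (product_part D1 D2 n)" by (rule homogeneous_product_part)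
    have "to_galg n ?c = galg_mult (partial_class_sum n D1) (partial_class_sum n D2)"
      using less.prems to_galg_circ[of "add_unit_rows (n - ydeg D1) D1" n "add_unit_rows (n - ydeg D2) D2"]
        to_galg_rho_basis_vec[of D1 n] to_galg_rho_basis_vec[of D2 n]
      by (simp add: rho_basis_vec ydeg_add_unit_rows)
    also have "\<dots> = to_galg n (\<Sum>k\<in>{?M..n}. product_part D1 D2 k)"
      by (rule galg_mult_eq_to_galg_product_parts) auto
    also have "{?M..n} = insert n {?M..<n}" using less.prems by auto
    also have "to_galg n (\<Sum>k\<in>insert n {?M..<n}. product_part D1 D2 k) =
        to_galg n (product_part D1 D2 n) + (\<Sum>k\<in>{?M..<n}. to_galg n (product_part D1 D2 k))"
      by (simp add: to_galg_linear)
    also have "(\<Sum>k\<in>{?M..<n}. to_galg n (product_part D1 D2 k)) = to_galg n ?s"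
      by (simp add: to_galg_linear rho_product_part(2))
    finally show "to_galg n (?c - ?s) = to_galg n (product_part D1 D2 n)"
      by (simp add: to_galg_linear)
  qed
  ultimately show ?case by simp
qed

lemma A_inf_mult_eq:
  "A_inf_mult = bilinear_ext
    (\<lambda>D1 D2. \<Sum>n = max (ydeg D1) (ydeg D2)..ydeg D1 + ydeg D2. product_part D1 D2 n)"
  unfolding A_inf_mult_def
  by (intro arg_cong[of _ _ bilinear_ext] ext sum.cong) (auto simp: brace_eq_product_part)

text \<open>The factorization numbers vanish in degrees above \<open>ydeg D1 + ydeg D2\<close>, so the range of summation in
  the definition of the product contains every degree that matters for any \<open>n\<close>.\<close>

lemma to_galg_A_inf_mult: "to_galg n (A_inf_mult x y) = galg_mult (to_galg n x) (to_galg n y)"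
proof -
  have "to_galg n (\<Sum>k = max (ydeg D1) (ydeg D2)..ydeg D1 + ydeg D2. product_part D1 D2 k) =
      galg_mult (partial_class_sum n D1) (partial_class_sum n D2)" for D1 D2
    by (rule galg_mult_eq_to_galg_product_parts[symmetric]) auto
  then show ?thesis
    unfolding A_inf_mult_eq galg_mult_def to_galg_def linear_ext_bilinear_ext bilinear_ext_linear_exts
    by simp
qed

lemma A_inf_mult_commute: "A_inf_mult x y = A_inf_mult y x"
  unfolding A_inf_mult_eq
  by (rule bilinear_ext_commute)
    (simp add: product_part_def factorization_number_commute max.commute add.commute)

theorem theorem2p1:
  shows "comm_assoc_algebra cscale A_inf_mult"
proof -
  have "A_inf_mult (A_inf_mult x y) z = A_inf_mult x (A_inf_mult y z)" for x y z
    by (rule to_galg_jointly_injective) (simp add: to_galg_A_inf_mult galg_mult_assoc)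
  moreover have "A_inf_mult (x + y) z = A_inf_mult x z + A_inf_mult y z"
    "A_inf_mult x (y + z) = A_inf_mult x y + A_inf_mult x z"
    "A_inf_mult (cscale c x) y = cscale c (A_inf_mult x y)"
    "A_inf_mult x (cscale c y) = cscale c (A_inf_mult x y)" for c x y z
    by (simp_all add: A_inf_mult_def bilinear_ext_linear)
  ultimately show ?thesis
    by (intro comm_assoc_algebra.intro vector_space_cscale comm_assoc_algebra_axioms.intro
        A_inf_mult_commute)
qed

end
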